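(* Let $m,n\in\mathbb N$ with $n,m\ge 2$, and let $M>0$. Then there exist matrices $A,B\in M_{10}(\mathbb C)$ such that $A$ and $B$ have identical pseudospectra and \[\frac{\|A^n\|}{\|B^n\|}>M\quad\text{and}\quad\frac{\|A^m\|}{\|B^m\|}>M.\]
   Context: For $N\ge 1$, $M_N(\mathbb C)$ is the algebra of complex $N\times N$ matrices, and $\|\cdot\|$ is the operator norm on $M_N(\mathbb C)$ associated with the Euclidean norm on $\mathbb C^N$. Two matrices $A,B\in M_N(\mathbb C)$ have identical pseudospectra if $\|(zI-A)^{-1}\|=\|(zI-B)^{-1}\|$ for all $z\in\mathbb C$, with the convention that $\|(zI-A)^{-1}\|=\infty$ if $z$ is an eigenvalue of $A$ (and likewise for $B$). Equivalently, $\sigma_\varepsilon(A)=\sigma_\varepsilon(B)$ for all $\varepsilon>0$, where $\sigma_\varepsilon(A):=\{z\in\mathbb C:\|(zI-A)^{-1}\|>1/\varepsilon\}$. *)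

theory Defs
  imports "HOL-Analysis.Analysis"
begin

text \<open>
  The norm on \<^typ>\<open>complex ^ 'n\<close> is the Euclidean one, so \<^const>\<open>onorm\<close> of the induced map is
  the operator norm. (The instance \<^term>\<open>norm\<close> on matrices is the Frobenius norm instead.)
\<close>

definition matrix_opnorm :: "complex ^ 'n ^ 'n \<Rightarrow> real" where
  "matrix_opnorm A = onorm (\<lambda>x. A *v x)"

text \<open>
  Multiplication and power in the class instance of \<^type>\<open>vec\<close> are componentwise, hence a
  separate definition of matrix powers.
\<close>

primrec matrix_power :: "complex ^ 'n ^ 'n \<Rightarrow> nat \<Rightarrow> complex ^ 'n ^ 'n" where
  "matrix_power A 0 = mat 1"
| "matrix_power A (Suc k) = A ** matrix_power A k"

definition is_eigenvalue :: "complex ^ 'n ^ 'n \<Rightarrow> complex \<Rightarrow> bool" where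
  "is_eigenvalue A z \<longleftrightarrow> (\<exists>v. v \<noteq> 0 \<and> A *v v = z *s v)"

text \<open>Here \<^term>\<open>mat z\<close> is the scalar matrix $zI$.\<close>

definition resolvent_norm :: "complex ^ 'n ^ 'n \<Rightarrow> complex \<Rightarrow> ereal" where
  "resolvent_norm A z =
     (if is_eigenvalue A z then \<infinity> else ereal (matrix_opnorm (matrix_inv (mat z - A))))"

definition identical_pseudospectra :: "complex ^ 'n ^ 'n \<Rightarrow> complex ^ 'n ^ 'n \<Rightarrow> bool" where
  "identical_pseudospectra A B \<longleftrightarrow> (\<forall>z. resolvent_norm A z = resolvent_norm B z)"

end

theory Submission
  imports Defs
begin

text \<open>
  Write $[a, x; 0, b]$ for the matrix with rows $(a, x)$ and $(0, b)$. A divided difference of a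
  Moebius map $f$ is the geometric mean of derivatives, $f[a,b]^2 = f'(a) f'(b)$, and resolvents are
  Moebius maps. So the block $[0, x; 0, 1]$ is dominated, as far as resolvent norms go, by the
  direct sum of $[0, c; 0, 0]$ and $[1, 1; 0, 1]$ once $c$ is of order $x^2$. A power
  $f(z) = z^k$ with $k \ge 2$ violates the identity at $0$ and $1$: there $f'(0) = 0$ and
  $f'(1) = k$, but $f[0,1] = 1$. Hence the $k$-th powers of the two dominating blocks stay bounded
  as $x \to \infty$, while that of the dominated block has norm at least $x$. Take $A$ to contain
  all three blocks, and $B$ to be $A$ with the entry $x$ erased.
\<close>

section \<open>Algebra of block matrices indexed by pairs\<close>

text \<open>Adding the two entries, instead of nesting the conditions, keeps the action on vectors
  uniform in \<open>i\<close>, fixed points of \<open>\<sigma>\<close> included. Powers and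
  resolvents of the matrices below keep this shape.\<close>

definition paired_matrix ::
    "('n \<Rightarrow> 'n) \<Rightarrow> ('n \<Rightarrow> complex) \<Rightarrow> ('n \<Rightarrow> complex) \<Rightarrow> complex ^ 'n ^ 'n" where
  "paired_matrix \<sigma> d w =
     (\<chi> i j. (if j = i then d i else 0) + (if j = \<sigma> i then w i else 0))"

lemma paired_matrix_mult_vec:
  "(paired_matrix \<sigma> d w *v x) $ i = d i * x $ i + w i * x $ \<sigma> i"
  by (simp add: paired_matrix_def matrix_vector_mult_def distrib_right sum.distrib
      if_distrib[of "\<lambda>c. c * _"] cong: if_cong)

lemma mat_eq_paired_matrix: "mat z = paired_matrix \<sigma> (\<lambda>i. z) (\<lambda>i. 0)"
  by (auto simp: paired_matrix_def mat_def vec_eq_iff)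

lemma paired_matrix_diff:
  "paired_matrix \<sigma> d w - paired_matrix \<sigma> d' w' =
   paired_matrix \<sigma> (\<lambda>i. d i - d' i) (\<lambda>i. w i - w' i)"
  by (auto simp: paired_matrix_def vec_eq_iff)

text \<open>The product of the two off-diagonal parts has the entries
  \<open>w i * w' (\<sigma> i)\<close>, coupling \<open>i\<close> to
  \<open>\<sigma> (\<sigma> i)\<close>; the assumption removes them.\<close>

lemma paired_matrix_mult:
  assumes "\<And>i. w i * w' (\<sigma> i) = 0"
  shows "paired_matrix \<sigma> d w ** paired_matrix \<sigma> d' w' =
    paired_matrix \<sigma> (\<lambda>i. d i * d' i) (\<lambda>i. d i * w' i + w i * d' (\<sigma> i))"
proof -
  have "w i = 0 \<or> w' (\<sigma> i) = 0" for i
    using assms by simp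
  then show ?thesis
    by (auto simp: matrix_eq vec_eq_iff paired_matrix_mult_vec algebra_simps
        simp flip: matrix_vector_mul_assoc)
qed

text \<open>The sum is the divided difference of \<open>z ^ k\<close> at \<open>d i\<close> and
  \<open>d (\<sigma> i)\<close>, in a form that also covers equal nodes, where it is the
  derivative.\<close>

lemma matrix_power_paired_matrix:
  assumes "\<And>i. w i * w (\<sigma> i) = 0"
  shows "matrix_power (paired_matrix \<sigma> d w) k =
    paired_matrix \<sigma> (\<lambda>i. d i ^ k) (\<lambda>i. w i * (\<Sum>l<k. d i ^ (k - Suc l) * d (\<sigma> i) ^ l))"
proof (induction k)
  case 0
  show ?case by (simp add: mat_eq_paired_matrix)
next
  case (Suc k)
  have "d i * (\<Sum>l<k. d i ^ (k - Suc l) * d (\<sigma> i) ^ l) =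
    (\<Sum>l<k. d i ^ (k - l) * d (\<sigma> i) ^ l)" for i
    unfolding sum_distrib_left
    by (rule sum.cong) (auto simp: Suc_diff_Suc simp flip: power_Suc mult.assoc)
  then have eq: "d i * (w i * (\<Sum>l<k. d i ^ (k - Suc l) * d (\<sigma> i) ^ l)) + w i * d (\<sigma> i) ^ k =
    w i * (\<Sum>l<Suc k. d i ^ (Suc k - Suc l) * d (\<sigma> i) ^ l)" for i
    by (simp add: algebra_simps)
  have "w i * (w (\<sigma> i) * u) = 0" for i u
    using assms[of i] by (metis mult.assoc mult_zero_left)
  then have "paired_matrix \<sigma> d w ** matrix_power (paired_matrix \<sigma> d w) k = paired_matrix \<sigma>
      (\<lambda>i. d i * d i ^ k)
      (\<lambda>i. d i * (w i * (\<Sum>l<k. d i ^ (k - Suc l) * d (\<sigma> i) ^ l)) + w i * d (\<sigma> i) ^ k)"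
    unfolding Suc by (rule paired_matrix_mult)
  then show ?case
    by (simp only: eq power_Suc matrix_power.simps)
qed

lemma matrix_inv_unique:
  fixes A :: "'a::field ^ 'n ^ 'n"
  assumes "A ** A' = mat 1"
  shows "matrix_inv A = A'"
proof -
  have "A' ** A = mat 1"
    using assms by (simp add: matrix_left_right_inverse)
  moreover have "A ** matrix_inv A = mat 1"
    unfolding matrix_inv_def
    using someI[of "\<lambda>A'. A ** A' = mat 1 \<and> A' ** A = mat 1" A'] assms calculation by blast
  ultimately show ?thesis
    by (metis matrix_mul_assoc matrix_mul_lid matrix_mul_rid)
qed

text \<open>Here the divided difference is that of \<open>1 / z\<close>.\<close>

lemma matrix_inv_paired_matrix:
  assumes "\<And>i. w i * w (\<sigma> i) = 0" and "\<And>i. d i \<noteq> 0"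
  shows "matrix_inv (paired_matrix \<sigma> d w) =
    paired_matrix \<sigma> (\<lambda>i. 1 / d i) (\<lambda>i. - w i / (d i * d (\<sigma> i)))"
  using assms
  by (intro matrix_inv_unique, subst paired_matrix_mult)
    (auto simp: mat_eq_paired_matrix[of _ \<sigma>])

section \<open>Operator norm and eigenvalues, block by block\<close>

lemma norm_vec_power2: "(norm x)\<^sup>2 = (\<Sum>i\<in>UNIV. (norm (x $ i))\<^sup>2)"
  by (simp add: norm_vec_def L2_set_def sum_nonneg)

lemma norm_Pair_power2: "(norm (a, b))\<^sup>2 = (norm a)\<^sup>2 + (norm b)\<^sup>2"
  by (simp add: norm_Pair)

text \<open>\<open>P\<close> holds the first members of disjoint pairs
  \<open>{i, \<sigma> i}\<close>; every index outside these pairs is a block of size one.\<close>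

locale index_pairing =
  fixes \<sigma> :: "'n::finite \<Rightarrow> 'n" and P :: "'n set"
  assumes inj: "inj_on \<sigma> P" and disjoint: "\<And>i. i \<in> P \<Longrightarrow> \<sigma> i \<notin> P"
begin

lemma sum_over_pairs:
  fixes f :: "'n \<Rightarrow> 'a::ab_group_add"
  shows "sum f UNIV = (\<Sum>i\<in>P. f i + f (\<sigma> i)) + sum f (- (P \<union> \<sigma> ` P))"
proof -
  have "sum f UNIV = sum f (P \<union> \<sigma> ` P) + sum f (- (P \<union> \<sigma> ` P))"
    using sum.subset_diff[of "P \<union> \<sigma> ` P" UNIV f]
    by (simp only: Compl_eq_Diff_UNIV subset_UNIV finite add.commute)
  also have "sum f (P \<union> \<sigma> ` P) = sum f P + sum f (\<sigma> ` P)"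
    using disjoint by (intro sum.union_disjoint) auto
  finally show ?thesis
    by (simp add: sum.reindex[OF inj] sum.distrib)
qed

text \<open>The matrix is an orthogonal direct sum of blocks of size two and one, so a norm bound
  holds iff it holds on each block. Working with bounds \<open>K\<close> avoids computing the norm
  of any block.\<close>

lemma matrix_opnorm_paired_matrix_le_iff:
  assumes w: "\<And>i. i \<notin> P \<Longrightarrow> w i = 0" and "K \<ge> 0"
  shows "matrix_opnorm (paired_matrix \<sigma> d w) \<le> K \<longleftrightarrow>
    (\<forall>i\<in>P. \<forall>a b. norm (d i * a + w i * b, d (\<sigma> i) * b) \<le> K * norm (a, b)) \<and>
    (\<forall>i. norm (d i) \<le> K)"
    (is "?L \<longleftrightarrow> ?R")
proof
  assume ?L
  then have bound: "norm (paired_matrix \<sigma> d w *v x) \<le> K * norm x" for x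
  proof -
    have "norm (paired_matrix \<sigma> d w *v x) \<le> matrix_opnorm (paired_matrix \<sigma> d w) * norm x"
      unfolding matrix_opnorm_def by (rule onorm) simp
    also have "\<dots> \<le> K * norm x"
      using \<open>?L\<close> by (intro mult_right_mono) auto
    finally show ?thesis .
  qed
  have block: "norm (d i * a + w i * b, d (\<sigma> i) * b) \<le> K * norm (a, b)" if "i \<in> P" for i a b
  proof -
    define x :: "complex ^ 'n" where "x = (\<chi> j. if j = i then a else if j = \<sigma> i then b else 0)"
    have ne: "\<sigma> i \<noteq> i"
      using disjoint[OF that] that by metis
    have two: "(\<Sum>j\<in>{i, \<sigma> i}. f j) \<le> sum f UNIV" if "\<And>j. f j \<ge> 0" for f :: "'n \<Rightarrow> real"
      using that by (intro sum_mono2) auto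
    have "(norm x)\<^sup>2 = (\<Sum>j\<in>{i, \<sigma> i}. (norm (x $ j))\<^sup>2)"
      unfolding norm_vec_power2 by (rule sum.mono_neutral_right) (auto simp: x_def)
    also have "\<dots> = (norm (a, b))\<^sup>2"
      using ne by (simp add: x_def norm_Pair_power2)
    finally have nx: "norm x = norm (a, b)"
      by (simp add: power2_eq_iff_nonneg)
    have "(norm (d i * a + w i * b, d (\<sigma> i) * b))\<^sup>2 =
      (\<Sum>j\<in>{i, \<sigma> i}. (norm ((paired_matrix \<sigma> d w *v x) $ j))\<^sup>2)"
      using ne w[OF disjoint[OF that]] by (simp add: paired_matrix_mult_vec x_def norm_Pair_power2)
    also have "\<dots> \<le> (norm (paired_matrix \<sigma> d w *v x))\<^sup>2"
      unfolding norm_vec_power2 by (rule two) simp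
    finally have "norm (d i * a + w i * b, d (\<sigma> i) * b) \<le> norm (paired_matrix \<sigma> d w *v x)"
      by (rule power2_le_imp_le) simp
    also have "\<dots> \<le> K * norm (a, b)"
      using bound[of x] nx by simp
    finally show ?thesis .
  qed
  moreover have "norm (d i) \<le> K" for i
  proof (cases "i \<in> P")
    case True
    have "norm (d i) \<le> norm (d i * 1 + w i * 0, d (\<sigma> i) * 0)"
      by simp
    also have "\<dots> \<le> K"
      using block[OF True, of 1 0] by simp
    finally show ?thesis .
  next
    case False
    define x :: "complex ^ 'n" where "x = axis i 1"
    have "norm (d i) = norm ((paired_matrix \<sigma> d w *v x) $ i)"
      by (simp add: x_def paired_matrix_mult_vec w[OF False])
    also have "\<dots> \<le> norm (paired_matrix \<sigma> d w *v x)"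
      by (rule Finite_Cartesian_Product.norm_nth_le)
    also have "\<dots> \<le> K"
      using bound[of x] by (simp add: x_def)
    finally show ?thesis .
  qed
  ultimately show ?R by blast
next
  assume R: ?R
  have "norm (paired_matrix \<sigma> d w *v x) \<le> K * norm x" for x
  proof (rule power2_le_imp_le)
    let ?y = "paired_matrix \<sigma> d w *v x"
    let ?rest = "- (P \<union> \<sigma> ` P)"
    have pair: "(norm (?y $ i))\<^sup>2 + (norm (?y $ \<sigma> i))\<^sup>2 \<le>
        K\<^sup>2 * ((norm (x $ i))\<^sup>2 + (norm (x $ \<sigma> i))\<^sup>2)" if "i \<in> P" for i
    proof -
      have "(norm (d i * x $ i + w i * x $ \<sigma> i, d (\<sigma> i) * x $ \<sigma> i))\<^sup>2 \<le>
          (K * norm (x $ i, x $ \<sigma> i))\<^sup>2"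
        using R that by (intro power_mono norm_ge_zero) blast
      then show ?thesis
        using w[OF disjoint[OF that]]
        by (simp add: paired_matrix_mult_vec norm_Pair_power2 power_mult_distrib)
    qed
    have single: "(norm (?y $ i))\<^sup>2 \<le> K\<^sup>2 * (norm (x $ i))\<^sup>2" if "i \<in> ?rest" for i
    proof -
      have "norm (d i) \<le> K"
        using R by blast
      then show ?thesis
        using w[of i] that
        by (simp add: paired_matrix_mult_vec norm_mult power_mult_distrib mult_right_mono power_mono)
    qed
    have "(norm ?y)\<^sup>2 \<le> (\<Sum>i\<in>P. K\<^sup>2 * ((norm (x $ i))\<^sup>2 + (norm (x $ \<sigma> i))\<^sup>2)) +
        (\<Sum>i\<in>?rest. K\<^sup>2 * (norm (x $ i))\<^sup>2)"
      unfolding norm_vec_power2 sum_over_pairs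
      by (intro add_mono sum_mono pair single)
    also have "\<dots> = (K * norm x)\<^sup>2"
      unfolding power_mult_distrib norm_vec_power2 sum_over_pairs
      by (simp add: sum_distrib_left distrib_left)
    finally show "(norm ?y)\<^sup>2 \<le> (K * norm x)\<^sup>2" .
  qed (use \<open>K \<ge> 0\<close> in simp)
  then show ?L
    unfolding matrix_opnorm_def by (rule onorm_le)
qed

text \<open>By the assumption on \<open>d\<close>, each diagonal value occurs at a first member
  \<open>i\<close> of a pair. Column \<open>i\<close> has no off-diagonal entry, so
  \<open>axis i 1\<close> is an eigenvector.\<close>

lemma is_eigenvalue_paired_matrix_iff:
  assumes w: "\<And>i. i \<notin> P \<Longrightarrow> w i = 0" and d: "range d = d ` P"
  shows "is_eigenvalue (paired_matrix \<sigma> d w) z \<longleftrightarrow> z \<in> range d"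
proof
  assume "z \<in> range d"
  then obtain i where i: "i \<in> P" "z = d i"
    using d by auto
  have "w k * axis i 1 $ \<sigma> k = 0" for k
    using w disjoint i by (cases "k \<in> P") (auto simp: axis_def)
  then have "paired_matrix \<sigma> d w *v axis i 1 = z *s axis i 1"
    by (simp add: vec_eq_iff paired_matrix_mult_vec i(2)) (simp add: axis_def)
  then show "is_eigenvalue (paired_matrix \<sigma> d w) z"
    unfolding is_eigenvalue_def by (metis axis_eq_0_iff zero_neq_one)
next
  assume "is_eigenvalue (paired_matrix \<sigma> d w) z"
  then obtain v where v: "v \<noteq> 0" "paired_matrix \<sigma> d w *v v = z *s v"
    unfolding is_eigenvalue_def by blast
  have eq: "d i * v $ i + w i * v $ \<sigma> i = z * v $ i" for i
    using v(2) by (simp add: vec_eq_iff paired_matrix_mult_vec)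
  show "z \<in> range d"
  proof (rule ccontr)
    assume z: "z \<notin> range d"
    \<comment> \<open>Back substitution: coordinates outside \<open>P\<close> vanish first, among
      them all second members, and then those in \<open>P\<close>.\<close>
    have outside: "v $ i = 0" if "i \<notin> P" for i
      using eq[of i] w[OF that] z by auto
    have "v $ i = 0" for i
      using eq[of i] outside z disjoint[of i] by (cases "i \<in> P") auto
    then show False
      using v(1) by (simp add: vec_eq_iff)
  qed
qed

end

section \<open>Norm estimates for triangular blocks of size two\<close>

lemma norm_triangular_block_le:
  fixes p q r a b :: "'a::real_normed_field"
  assumes "norm p \<le> K" and "norm q \<le> K" and "K + norm r \<le> L"
  shows "norm (p * a + r * b, q * b) \<le> L * norm (a, b)"
proof -
  have "norm (p * a, q * b) \<le> K * norm (a, b)"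
  proof (rule power2_le_imp_le)
    have "(norm p * norm a)\<^sup>2 \<le> (K * norm a)\<^sup>2" "(norm q * norm b)\<^sup>2 \<le> (K * norm b)\<^sup>2"
      using assms by (auto intro!: power_mono mult_right_mono)
    then show "(norm (p * a, q * b))\<^sup>2 \<le> (K * norm (a, b))\<^sup>2"
      by (simp add: norm_Pair_power2 norm_mult power_mult_distrib distrib_left)
    show "0 \<le> K * norm (a, b)"
      using order_trans[OF norm_ge_zero assms(1)] by simp
  qed
  moreover have "norm (r * b, 0 :: 'a) \<le> norm r * norm (a, b)"
    using norm_snd_le[of b a] by (simp add: norm_Pair norm_mult mult_left_mono)
  moreover have "norm (p * a + r * b, q * b) \<le> norm (p * a, q * b) + norm (r * b, 0 :: 'a)"
    using norm_triangle_ineq[of "(p * a, q * b)" "(r * b, 0)"] by simp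
  ultimately have "norm (p * a + r * b, q * b) \<le> (K + norm r) * norm (a, b)"
    by (simp add: distrib_right)
  also have "\<dots> \<le> L * norm (a, b)"
    using assms(3) by (intro mult_right_mono) auto
  finally show ?thesis .
qed

text \<open>Tested on a vector with \<open>norm a = norm b\<close> whose phases make
  \<open>p * a\<close> and \<open>r * b\<close> positive multiples of \<open>r\<close>, so that no
  cancellation occurs.\<close>

lemma jordan_block_bound:
  fixes p r :: complex
  assumes "p \<noteq> 0" and "r \<noteq> 0" and "K \<ge> 0"
    and bound: "\<And>a b. norm (p * a + r * b, p * b) \<le> K * norm (a, b)"
  shows "norm p + norm r / 2 \<le> K"
proof -
  define s where "s = norm p * norm r"
  define a where "a = cnj p * r"
  define b where "b = complex_of_real s"
  have "s > 0"
    using assms by (simp add: s_def)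
  have na: "norm a = s" and nb: "norm b = s"
    using \<open>s > 0\<close> by (simp_all add: a_def b_def s_def norm_mult)
  have "p * a + r * b = r * of_real (norm p * (norm p + norm r))"
    using complex_norm_square[of p]
    by (simp add: a_def b_def s_def algebra_simps power2_eq_square)
  then have "norm (p * a + r * b) = s * (norm p + norm r)"
    by (simp add: norm_mult s_def del: of_real_add of_real_mult)
  moreover have "(norm (p * a + r * b, p * b))\<^sup>2 \<le> (K * norm (a, b))\<^sup>2"
    using bound by (intro power_mono) auto
  ultimately have "(s * (norm p + norm r))\<^sup>2 + (norm p * s)\<^sup>2 \<le> K\<^sup>2 * (s\<^sup>2 + s\<^sup>2)"
    by (simp only: norm_Pair_power2 norm_mult na nb power_mult_distrib)
  then have "s\<^sup>2 * ((norm p + norm r)\<^sup>2 + (norm p)\<^sup>2) \<le> s\<^sup>2 * (2 * K\<^sup>2)"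
    unfolding power_mult_distrib by (simp only: distrib_left mult_2 mult.commute)
  then have "(norm p + norm r)\<^sup>2 + (norm p)\<^sup>2 \<le> 2 * K\<^sup>2"
    using \<open>s > 0\<close> by simp
  \<comment> \<open>The quadratic mean of \<open>norm p + norm r\<close> and \<open>norm p\<close>
    is at least their arithmetic mean.\<close>
  moreover have "2 * (norm p + norm r / 2)\<^sup>2 \<le> (norm p + norm r)\<^sup>2 + (norm p)\<^sup>2"
    by (simp add: power2_eq_square algebra_simps)
  ultimately show ?thesis
    using \<open>K \<ge> 0\<close> by - (rule power2_le_imp_le; linarith)
qed

text \<open>With \<open>p\<close> and \<open>q\<close> the moduli of \<open>1 / z\<close> and
  \<open>1 / (z - 1)\<close>, the Jordan blocks force \<open>K\<close> above \<open>p\<close> and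
  \<open>q\<close> by \<open>2 * (x + 1)\<^sup>2 * p\<^sup>2\<close> and
  \<open>q\<^sup>2 / 2\<close>. The constant 4 makes the geometric mean of these excesses exactly
  \<open>(x + 1) * (p * q)\<close>, so the larger one is at least that.\<close>

lemma resolvent_block_dominated:
  fixes z :: complex and x K :: real
  assumes z: "z \<noteq> 0" "z \<noteq> 1" and "x \<ge> 0" and "K \<ge> 0"
    and zero: "\<And>a b. norm (1 / z * a + of_real (4 * (x + 1)\<^sup>2) / (z * z) * b, 1 / z * b) \<le>
      K * norm (a, b)"
    and one: "\<And>a b. norm (1 / (z - 1) * a + 1 / ((z - 1) * (z - 1)) * b, 1 / (z - 1) * b) \<le>
      K * norm (a, b)"
  shows "norm (1 / z * a + of_real x / (z * (z - 1)) * b, 1 / (z - 1) * b) \<le> K * norm (a, b)"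
proof -
  define p where "p = norm (1 / z)"
  define q where "q = norm (1 / (z - 1))"
  have pos: "p > 0" "q > 0"
    using z by (auto simp: p_def q_def)
  have "x + 1 \<noteq> 0"
    using \<open>x \<ge> 0\<close> by linarith
  then have "of_real (4 * (x + 1)\<^sup>2) / (z * z) \<noteq> 0"
    using z by (simp del: of_real_add)
  then have "norm (1 / z) + norm (of_real (4 * (x + 1)\<^sup>2) / (z * z)) / 2 \<le> K"
    using z \<open>K \<ge> 0\<close> zero by (intro jordan_block_bound) auto
  moreover have "norm (of_real (4 * (x + 1)\<^sup>2) / (z * z)) = 4 * (x + 1)\<^sup>2 * p\<^sup>2"
    by (simp only: p_def norm_divide norm_mult norm_of_real norm_one) (simp add: power2_eq_square)
  ultimately have P: "p + 2 * (x + 1)\<^sup>2 * p\<^sup>2 \<le> K"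
    by (simp add: p_def)
  have "norm (1 / (z - 1)) + norm (1 / ((z - 1) * (z - 1))) / 2 \<le> K"
    using z \<open>K \<ge> 0\<close> one by (intro jordan_block_bound) auto
  then have Q: "q + q\<^sup>2 / 2 \<le> K"
    by (simp add: q_def norm_divide norm_mult power2_eq_square)
  \<comment> \<open>The resolvent identity: \<open>p\<close> and \<open>q\<close> differ by at most
    \<open>p * q\<close>. This turns \<open>min p q\<close> into \<open>max p q\<close> below at the
    cost of one \<open>p * q\<close>, hence \<open>x + 1\<close> instead of
    \<open>x\<close>.\<close>
  have "1 / z - 1 / (z - 1) = - (1 / z * (1 / (z - 1)))"
    using z by (simp add: field_simps)
  then have "norm (1 / z - 1 / (z - 1)) = p * q"
    by (metis norm_minus_cancel norm_mult p_def q_def)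
  then have close: "\<bar>p - q\<bar> \<le> p * q"
    unfolding p_def q_def by (metis norm_triangle_ineq3)
  \<comment> \<open>The threshold is where the two excesses are equal.\<close>
  have "min p q + (x + 1) * (p * q) \<le> K"
  proof (cases "q \<le> 2 * (x + 1) * p")
    case True
    have "(x + 1) * p * q \<le> (x + 1) * p * (2 * (x + 1) * p)"
      using True pos \<open>x \<ge> 0\<close> by (intro mult_left_mono) auto
    then show ?thesis
      using P by (simp add: power2_eq_square algebra_simps min_def split: if_splits)
  next
    case False
    then have "q * (2 * (x + 1) * p) \<le> q * q"
      using pos by (intro mult_left_mono) auto
    then show ?thesis
      using Q by (simp add: power2_eq_square algebra_simps min_def split: if_splits)
  qed
  then have "max p q + x * (p * q) \<le> K"
    using close by (auto simp: min_def max_def distrib_right split: if_splits)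
  moreover have "norm (of_real x / (z * (z - 1))) = x * (p * q)"
    using \<open>x \<ge> 0\<close> by (simp add: p_def q_def norm_divide norm_mult)
  ultimately show ?thesis
    by (intro norm_triangular_block_le[where K = "max p q"]) (auto simp: p_def q_def)
qed

section \<open>The example in dimension ten\<close>

theorem theorem1p1:
  fixes m n :: nat and M :: real
  assumes "n \<ge> 2" and "m \<ge> 2" and "M > 0"
  shows "\<exists>A B :: complex ^ 10 ^ 10.
    identical_pseudospectra A B \<and>
    matrix_opnorm (matrix_power A n) / matrix_opnorm (matrix_power B n) > M \<and>
    matrix_opnorm (matrix_power A m) / matrix_opnorm (matrix_power B m) > M"
proof -
  \<comment> \<open>Exceeds \<open>M * (1 + real k)\<close> for every \<open>k\<close> up to
    \<open>n + m - 1\<close>, in particular for \<open>n\<close> and \<open>m\<close>.\<close>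
  define x where "x = M * (real n + real m + 1)"
  have "x \<ge> 0"
    using \<open>M > 0\<close> by (simp add: x_def)
  define P :: "10 set" where "P = {0, 2, 4}"
  define \<sigma> :: "10 \<Rightarrow> 10" where "\<sigma> = (\<lambda>i. i + 1)"
  interpret index_pairing \<sigma> P
    by unfold_locales (auto simp: P_def \<sigma>_def)
  \<comment> \<open>With \<open>w t\<close> below, the pairs (0,1), (2,3), (4,5) carry
    \<open>[0, c; 0, 0]\<close>, \<open>[1, 1; 0, 1]\<close> and \<open>[0, t; 0, 1]\<close>, where
    c is \<open>4 * (x + 1)\<^sup>2\<close>; indices 6 to 9 are zero padding. \<open>A\<close> is
    the case \<open>t = x\<close> and \<open>B\<close> the case \<open>t = 0\<close>.\<close>
  define d :: "10 \<Rightarrow> complex" where "d = (\<lambda>i. if i \<in> {2, 3, 5} then 1 else 0)"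
  define w :: "real \<Rightarrow> 10 \<Rightarrow> complex" where
    "w = (\<lambda>t i. if i = 0 then of_real (4 * (x + 1)\<^sup>2) else if i = 2 then 1
      else if i = 4 then of_real t else 0)"
  let ?T = "\<lambda>t. paired_matrix \<sigma> d (w t)"
  have w_outside: "w t i = 0" if "i \<notin> P" for t i
    using that by (auto simp: w_def P_def)
  have w_mult: "w t i * w t (\<sigma> i) = 0" for t i
    using w_outside disjoint by (cases "i \<in> P") auto
  have d_P: "d ` P = {0, 1}"
    by (auto simp: d_def P_def)
  have range_d: "range d = {0, 1}"
  proof
    show "{0, 1} \<subseteq> range d"
      unfolding d_P[symmetric] by (rule image_mono) simp
  qed (auto simp: d_def)
  have eigenvalue: "is_eigenvalue (?T t) z \<longleftrightarrow> z \<in> {0, 1}" for t z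
    using is_eigenvalue_paired_matrix_iff[of "w t" d z] w_outside by (simp add: range_d d_P)

  have resolvent: "matrix_inv (mat z - ?T t) =
      paired_matrix \<sigma> (\<lambda>i. 1 / (z - d i)) (\<lambda>i. w t i / ((z - d i) * (z - d (\<sigma> i))))"
    if "z \<noteq> 0" "z \<noteq> 1" for z t
    using that w_mult
    by (simp add: mat_eq_paired_matrix[of _ \<sigma>] paired_matrix_diff matrix_inv_paired_matrix d_def)
  \<comment> \<open>Two nonnegative reals with the same upper bounds \<open>K \<ge> 0\<close> are
    equal, so only block inequalities need comparing.\<close>
  have iff: "matrix_opnorm (matrix_inv (mat z - ?T x)) \<le> K \<longleftrightarrow>
      matrix_opnorm (matrix_inv (mat z - ?T 0)) \<le> K"
    if z: "z \<noteq> 0" "z \<noteq> 1" and "K \<ge> 0" for z K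
  proof -
    have diag: "norm (p * a, q * b) \<le> K * norm (a, b)"
      if "norm p \<le> K" "norm q \<le> K" for p q a b :: complex
      using norm_triangular_block_le[of p K q 0 K a b] that by simp
    have le_iff: "matrix_opnorm (matrix_inv (mat z - ?T t)) \<le> K \<longleftrightarrow>
        (\<forall>a b. norm (1 / z * a + of_real (4 * (x + 1)\<^sup>2) / (z * z) * b, 1 / z * b) \<le>
          K * norm (a, b)) \<and>
        (\<forall>a b. norm (1 / (z - 1) * a + 1 / ((z - 1) * (z - 1)) * b, 1 / (z - 1) * b) \<le>
          K * norm (a, b)) \<and>
        (\<forall>a b. norm (1 / z * a + of_real t / (z * (z - 1)) * b, 1 / (z - 1) * b) \<le>
          K * norm (a, b)) \<and>
        (\<forall>i. norm (1 / (z - d i)) \<le> K)" for t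
      unfolding resolvent[OF z]
      using matrix_opnorm_paired_matrix_le_iff[where w = "\<lambda>i. w t i / ((z - d i) * (z - d (\<sigma> i)))"
          and d = "\<lambda>i. 1 / (z - d i)", OF _ \<open>K \<ge> 0\<close>] w_outside
      by (simp add: P_def) (simp add: \<sigma>_def w_def d_def conj_assoc)
    \<comment> \<open>For \<open>t = 0\<close> the third block is diagonal and obeys the bound on
      the diagonal entries; for \<open>t = x\<close> it is dominated by the other two
      blocks.\<close>
    have "norm (1 / z * a + of_real t / (z * (z - 1)) * b, 1 / (z - 1) * b) \<le> K * norm (a, b)"
      if "\<forall>i. norm (1 / (z - d i)) \<le> K" and "t = 0" for t a b
      using diag[of "1 / z" "1 / (z - 1)" a b] spec[OF that(1), of 0] spec[OF that(1), of 2] \<open>t = 0\<close>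
      by (simp add: d_def)
    then show ?thesis
      unfolding le_iff using resolvent_block_dominated[OF z \<open>x \<ge> 0\<close> \<open>K \<ge> 0\<close>] by blast
  qed
  have nonneg: "matrix_opnorm A \<ge> 0" for A :: "complex ^ 10 ^ 10"
    by (simp add: matrix_opnorm_def onorm_pos_le)
  have "resolvent_norm (?T x) z = resolvent_norm (?T 0) z" for z
  proof (cases "z \<in> {0, 1}")
    case False
    then have "matrix_opnorm (matrix_inv (mat z - ?T x)) = matrix_opnorm (matrix_inv (mat z - ?T 0))"
      by (intro order_antisym) (simp add: iff nonneg, simp flip: iff add: nonneg)
    then show ?thesis
      by (simp add: resolvent_norm_def eigenvalue)
  qed (simp add: resolvent_norm_def eigenvalue)
  then have pseudo: "identical_pseudospectra (?T x) (?T 0)"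
    by (simp add: identical_pseudospectra_def)

  have ratio: "matrix_opnorm (matrix_power (?T x) k) / matrix_opnorm (matrix_power (?T 0) k) > M"
    if "k \<ge> 2" and "k \<le> n + m - 1" for k
  proof -
    define e where "e = (\<lambda>t i. w t i * (\<Sum>l<k. d i ^ (k - Suc l) * d (\<sigma> i) ^ l))"
    have power: "matrix_power (?T t) k = paired_matrix \<sigma> (\<lambda>i. d i ^ k) (e t)" for t
      by (simp add: matrix_power_paired_matrix w_mult e_def)
    have e_outside: "e t i = 0" if "i \<notin> P" for t i
      using w_outside[OF that] by (simp add: e_def)
    \<comment> \<open>The derivative of \<open>z ^ k\<close> at 0: the exponents in each term add up
      to \<open>k - 1 \<ge> 1\<close>, so some factor is 0.\<close>
    have e0: "e t 0 = 0" for t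
      using \<open>k \<ge> 2\<close> by (auto simp: e_def d_def \<sigma>_def power_0_left intro!: sum.neutral)
    have e2: "e t 2 = of_nat k" for t
      by (simp add: e_def d_def \<sigma>_def w_def)
    \<comment> \<open>Only \<open>l = k - 1\<close> survives, through \<open>0 ^ 0 = 1\<close>: the
      divided difference at 0 and 1 is 1.\<close>
    have "(\<Sum>l<k. (0 :: complex) ^ (k - Suc l)) = (\<Sum>l\<in>{k - 1}. 0 ^ (k - Suc l))"
      using \<open>k \<ge> 2\<close> by (intro sum.mono_neutral_right) (auto simp: power_0_left)
    then have e4: "e t 4 = of_real t" for t
      by (simp add: e_def d_def \<sigma>_def w_def)
    have le_iff: "matrix_opnorm (matrix_power (?T t) k) \<le> K \<longleftrightarrow>
        (\<forall>i\<in>P. \<forall>a b. norm (d i ^ k * a + e t i * b, d (\<sigma> i) ^ k * b) \<le> K * norm (a, b)) \<and>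
        (\<forall>i. norm (d i ^ k) \<le> K)" if "K \<ge> 0" for t K
      unfolding power using e_outside that by (rule matrix_opnorm_paired_matrix_le_iff)
    have d_le: "norm (d i ^ k) \<le> 1" for i
      by (simp add: d_def power_0_left)
    have upper: "matrix_opnorm (matrix_power (?T 0) k) \<le> 1 + real k"
    proof (intro le_iff[THEN iffD2] conjI ballI allI)
      fix i a b
      assume "i \<in> P"
      then have "norm (e 0 i) \<le> real k"
        by (auto simp: P_def e0 e2 e4)
      then show "norm (d i ^ k * a + e 0 i * b, d (\<sigma> i) ^ k * b) \<le> (1 + real k) * norm (a, b)"
        by (intro norm_triangular_block_le[OF d_le d_le]) simp
    next
      show "norm (d i ^ k) \<le> 1 + real k" for i
        using d_le[of i] by linarith
    qed auto
    \<comment> \<open>Taking the norm itself as \<open>K\<close> turns the criterion into lower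
      bounds for it.\<close>
    note bounds = le_iff[OF nonneg, THEN iffD1, OF order_refl]
    \<comment> \<open>The diagonal entry 1 keeps the denominator of the ratio positive.\<close>
    have "norm (d 2 ^ k) \<le> matrix_opnorm (matrix_power (?T 0) k)"
      by (rule conjunct2[OF bounds, rule_format])
    then have lower: "1 \<le> matrix_opnorm (matrix_power (?T 0) k)"
      by (simp add: d_def)
    have "norm (d 4 ^ k * 0 + e x 4 * 1, d (\<sigma> 4) ^ k * 1) \<le>
        matrix_opnorm (matrix_power (?T x) k) * norm (0 :: complex, 1 :: complex)"
      by (rule conjunct1[OF bounds, rule_format]) (simp add: P_def)
    then have "x \<le> matrix_opnorm (matrix_power (?T x) k)"
      using norm_fst_le[of "of_real x :: complex" "d (\<sigma> 4) ^ k"] \<open>x \<ge> 0\<close> by (simp add: e4)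
    moreover have "M * (1 + real k) < x"
      using that \<open>M > 0\<close> by (auto simp: x_def)
    moreover have "M * matrix_opnorm (matrix_power (?T 0) k) \<le> M * (1 + real k)"
      using upper \<open>M > 0\<close> by simp
    ultimately show ?thesis
      using lower by (simp add: pos_less_divide_eq)
  qed
  show ?thesis
    using pseudo ratio[of n] ratio[of m] assms by (intro exI[of _ "?T x"] exI[of _ "?T 0"]) auto
qed

end
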